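(* Consider the two-dimensional TM$_z$ Maxwell system (constant $\mu,\epsilon,\sigma$) on a domain split by an interface $\Gamma$ into $\Omega^+$ and $\Omega^-$, discretized by the fourth-order staggered finite difference scheme combined with the RK4 method and the correction function method (CFM). Assume that the source term $\boldsymbol{f}_1=(f_{1_x},f_{1_y})$ satisfies $$\big(\tilde\nabla\cdot\boldsymbol{f}_1\big)_{i+1/2,j+1/2}^{n}=0$$ for all $i,j$ and all $n\ge0$, and assume that the approximation of the correction function $\hat D_{E_z}$ at each node is unique. If the computation of $\big(\tilde\nabla\cdot\boldsymbol{H}\big)_{i+1/2,j+1/2}^{\circ,n+1}$, where the superscript $\circ$ is $+$ or $-$ according to whether the node $(x_{i+1/2},y_{j+1/2})$ belongs to $\Omega^+$ or $\Omega^-$, involves only approximations of the magnetic field in the same subdomain (that is, all nodes of the components $H_x,H_y$ in the discrete divergence stencil at $(x_{i+1/2},y_{j+1/2})$ belong to $\Omega^{\circ}$), then the approximation of $\boldsymbol{H}$ computed by this scheme satisfies $$\big(\tilde\nabla\cdot\boldsymbol{H}\big)_{i+1/2,j+1/2}^{\circ,n+1}=\big(\tilde\nabla\cdot\boldsymbol{H}\big)_{i+1/2,j+1/2}^{\circ,0}$$ for all such $i,j$ and all $n\ge 0$.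
   Context: PDE system (TM$_z$ mode) for $H_x,H_y,E_z$ as functions of $(x,y,t)$, with constant physical parameters $\mu,\epsilon>0$ and $\sigma\geq 0$: $$\mu\,\partial_tH_x+\partial_yE_z=f_{1_x},\quad \mu\,\partial_tH_y-\partial_xE_z=f_{1_y},\quad \epsilon\,\partial_tE_z-\partial_xH_y+\partial_yH_x=-\sigma E_z+f_2,\quad \partial_xH_x+\partial_yH_y=0,$$ in $\Omega^+$ and $\Omega^-$, with sources $\boldsymbol{f}_{1}^\pm,f_2^\pm$ in $\Omega^\pm$; the interface $\Gamma$ is stationary and the fields may jump across it. Grid: rectangle $[x_\ell,x_r]\times[y_b,y_t]$, $\Delta x=(x_r-x_\ell)/N_x$, $\Delta y=(y_t-y_b)/N_y$, $x_{i+1/2}=x_\ell+i\Delta x$, $x_i=x_\ell+(i-\tfrac12)\Delta x$, and similarly $y_{j+1/2}=y_b+j\Delta y$, $y_j=y_b+(j-\tfrac12)\Delta y$; time levels $t_n=n\Delta t$. A superscript $n$ denotes time $t_n$. Unknowns are staggered in space and not in time: $H^n_{x,i,j+1/2}\approx H_x(x_i,y_{j+1/2},t_n)$, $H^n_{y,i+1/2,j}\approx H_y(x_{i+1/2},y_j,t_n)$, $E^n_{z,i,j}\approx E_z(x_i,y_j,t_n)$. The sources $f_{1_x},f_{1_y}$ are evaluated at the $H_x$- and $H_y$-points respectively. Every node belongs to $\Omega^+$ or $\Omega^-$, and values carry the superscript $+$ or $-$ of their node's subdomain. Uncorrected spatial derivatives: the fourth-order centered staggered difference, e.g. $$(\partial_{y_h}E_z)_{i,j+1/2}=\frac{E_{z,i,j-1}-27E_{z,i,j}+27E_{z,i,j+1}-E_{z,i,j+2}}{24\Delta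 y},\qquad (\partial_{x_h}E_z)_{i+1/2,j}=\frac{E_{z,i-1,j}-27E_{z,i,j}+27E_{z,i+1,j}-E_{z,i+2,j}}{24\Delta x},$$ and analogously $\partial_{x_h}H_y$, $\partial_{y_h}H_x$ at cell centers. CFM correction: the correction functions are the jumps $D_{H_x}=H_x^+-H_x^-$, $D_{H_y}=H_y^+-H_y^-$, $D_{E_z}=E_z^+-E_z^-$ of smooth extensions of the fields near $\Gamma$; computed approximations of them (polynomials in space-time on local patches near $\Gamma$) are available at the nodes near $\Gamma$. At Runge-Kutta stage $m\in\{1,2,3,4\}$ of the step from $t_n$ to $t_{n+1}$ one uses modified values $\hat{\boldsymbol{D}}^n_m$ which, for $\boldsymbol{D}^n=[D^n_{H_x},D^n_{H_y},D^n_{E_z}]^T$, are: $\hat{\boldsymbol{D}}^n_1=\boldsymbol{D}^n$, $\hat{\boldsymbol{D}}^n_2\approx\boldsymbol{D}^n+\frac{\Delta t}2\partial_t\boldsymbol{D}^n$, $\hat{\boldsymbol{D}}^n_3\approx\boldsymbol{D}^n+\frac{\Delta t}2\partial_t\boldsymbol{D}^n+\frac{\Delta t^2}4\partial_t^2\boldsymbol{D}^n$, $\hat{\boldsymbol{D}}^n_4\approx\boldsymbol{D}^n+\Delta t\,\partial_t\boldsymbol{D}^n+\frac{\Delta t^2}2\partial_t^2\boldsymbol{D}^n+\frac{\Delta t^3}4\partial_t^3\boldsymbol{D}^n$, the time derivatives being computed from the polynomial approximations. When a finite difference is evaluated at a node in $\Omega^+$, each stencil value at a node of $\Omega^-$ is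 replaced by that value plus the corresponding $\hat D$ at that node and stage; when it is evaluated at a node in $\Omega^-$, each stencil value at a node of $\Omega^+$ is replaced by that value minus the corresponding $\hat D$. "Unique" means that the value $\hat D_{E_z}$ at a given $E_z$-node and stage is the same in every finite difference stencil that uses it. Time stepping: with $\boldsymbol{U}^n=[H_x^n,H_y^n,E_z^n]^T$ and $$\boldsymbol{G}(t,\boldsymbol{U})=\Big[\tfrac1\mu(f_{1_x}(t)-\partial_{y_h}E_z),\ \tfrac1\mu(f_{1_y}(t)+\partial_{x_h}E_z),\ \tfrac1\epsilon(-\sigma E_z+f_2(t)+\partial_{x_h}H_y-\partial_{y_h}H_x)\Big]^T$$ (where each spatial difference $\partial_{x_h},\partial_{y_h}$ is the fourth-order centered staggered difference with the CFM correction just described), $\boldsymbol{U}^{n+1}=\boldsymbol{U}^n+\frac16(\boldsymbol{k}_1+2\boldsymbol{k}_2+2\boldsymbol{k}_3+\boldsymbol{k}_4)$, where $\boldsymbol{k}_1=\Delta t\,\boldsymbol{G}(t_n,\boldsymbol{U}^n)$, $\boldsymbol{k}_2=\Delta t\,\boldsymbol{G}(t_n+\frac{\Delta t}2,\boldsymbol{U}^n+\frac{\boldsymbol{k}_1}2)$, $\boldsymbol{k}_3=\Delta t\,\boldsymbol{G}(t_n+\frac{\Delta t}2,\boldsymbol{U}^n+\frac{\boldsymbol{k}_2}2)$, $\boldsymbol{k}_4=\Delta t\,\boldsymbol{G}(t_n+\Delta t,\boldsymbol{U}^n+\boldsymbol{k}_3)$, stage $m$ using $\hat{\boldsymbol D}^n_m$.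 Fourth-order discrete divergence at cell corners of a staggered field $\boldsymbol{A}=(A_x,A_y)$ (with $A_x$ located at $H_x$-points and $A_y$ at $H_y$-points): $$\big(\tilde\nabla\cdot\boldsymbol{A}\big)^n_{i+1/2,j+1/2}=\frac{A^n_{x,i-1,j+1/2}-27A^n_{x,i,j+1/2}+27A^n_{x,i+1,j+1/2}-A^n_{x,i+2,j+1/2}}{24\Delta x}+\frac{A^n_{y,i+1/2,j-1}-27A^n_{y,i+1/2,j}+27A^n_{y,i+1/2,j+1}-A^n_{y,i+1/2,j+2}}{24\Delta y}.$$ No restriction is placed on which subdomains the $E_z$-nodes involved belong to.
   Formalization: The discrete divergence of f_1 is assumed to vanish also at the half time levels t_n + Δt/2, where RK4 evaluates the source; with only the levels t_n the claim is false (e.g. f_1x = x sin²(πt), f_1y = 0, Δt = 1). *)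

theory Defs
  imports Complex_Main "HOL-Computational_Algebra.Polynomial"
begin

datatype side = Plus | Minus

text \<open>
  The staggered nodes, with (x_l, y_b) the lower left corner of the rectangle:
  \<^item> \<open>HxN i j\<close> is the H_x-node (x_i, y_{j+1/2}),
  \<^item> \<open>HyN i j\<close> is the H_y-node (x_{i+1/2}, y_j),
  \<^item> \<open>EzN i j\<close> is the E_z-node (x_i, y_j).

  A discrete state U = (H_x, H_y, E_z) is a function \<open>node \<Rightarrow> real\<close>; its values at nodes outside
  the grid are irrelevant.
\<close>
datatype node = HxN int int | HyN int int | EzN int int

text \<open>
  Data of the problem and of its discretization. Sources take the subdomain, the time and the point.
  \<open>corr_poly n s r\<close> is the space-time polynomial (outermost variable x, then y, then t) which, in
  the step from t_n to t_{n+1}, the finite difference evaluated at \<open>s\<close> uses near \<open>r\<close> as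
  approximation of the correction function: of D_Hx, D_Hy or D_Ez according to the kind of the
  stencil node \<open>r\<close>. Since it may depend on \<open>s\<close>, different stencils may take the
  correction at one and the same node from different local patches.
\<close>
record tmz =
  mu :: real
  eps :: real
  sigma :: real
  Omega :: "side \<Rightarrow> (real \<times> real) set"
  Gamma :: "(real \<times> real) set"
  f1x :: "side \<Rightarrow> real \<Rightarrow> real \<times> real \<Rightarrow> real"
  f1y :: "side \<Rightarrow> real \<Rightarrow> real \<times> real \<Rightarrow> real"
  f2 :: "side \<Rightarrow> real \<Rightarrow> real \<times> real \<Rightarrow> real"
  x_l :: real
  x_r :: real
  y_b :: real
  y_t :: real
  Nx :: nat
  Ny :: nat
  dt :: real
  corr_poly :: "nat \<Rightarrow> node \<Rightarrow> node \<Rightarrow> real poly poly poly"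

definition dx :: "tmz \<Rightarrow> real" where
  "dx P = (x_r P - x_l P) / real (Nx P)"

definition dy :: "tmz \<Rightarrow> real" where
  "dy P = (y_t P - y_b P) / real (Ny P)"

definition x_cen :: "tmz \<Rightarrow> int \<Rightarrow> real" where
  "x_cen P i = x_l P + (of_int i - 1/2) * dx P"

definition x_half :: "tmz \<Rightarrow> int \<Rightarrow> real" where
  "x_half P i = x_l P + of_int i * dx P"

definition y_cen :: "tmz \<Rightarrow> int \<Rightarrow> real" where
  "y_cen P j = y_b P + (of_int j - 1/2) * dy P"

definition y_half :: "tmz \<Rightarrow> int \<Rightarrow> real" where
  "y_half P j = y_b P + of_int j * dy P"

definition tm :: "tmz \<Rightarrow> nat \<Rightarrow> real" where
  "tm P n = real n * dt P"

fun pos :: "tmz \<Rightarrow> node \<Rightarrow> real \<times> real" where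
  "pos P (HxN i j) = (x_cen P i, y_half P j)"
| "pos P (HyN i j) = (x_half P i, y_cen P j)"
| "pos P (EzN i j) = (x_cen P i, y_cen P j)"

definition corner_pos :: "tmz \<Rightarrow> int \<Rightarrow> int \<Rightarrow> real \<times> real" where
  "corner_pos P i j = (x_half P i, y_half P j)"

definition grid_nodes :: "tmz \<Rightarrow> node set" where
  "grid_nodes P =
     {HxN i j | i j. 1 \<le> i \<and> i \<le> int (Nx P) \<and> 0 \<le> j \<and> j \<le> int (Ny P)}
   \<union> {HyN i j | i j. 0 \<le> i \<and> i \<le> int (Nx P) \<and> 1 \<le> j \<and> j \<le> int (Ny P)}
   \<union> {EzN i j | i j. 1 \<le> i \<and> i \<le> int (Nx P) \<and> 1 \<le> j \<and> j \<le> int (Ny P)}"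

definition grid_corners :: "tmz \<Rightarrow> (real \<times> real) set" where
  "grid_corners P =
     {corner_pos P i j | i j. 0 \<le> i \<and> i \<le> int (Nx P) \<and> 0 \<le> j \<and> j \<le> int (Ny P)}"

definition admissible :: "tmz \<Rightarrow> bool" where
  "admissible P \<longleftrightarrow>
     mu P > 0 \<and> eps P > 0 \<and> sigma P \<ge> 0 \<and>
     x_l P < x_r P \<and> y_b P < y_t P \<and> Nx P > 0 \<and> Ny P > 0 \<and> dt P > 0 \<and>
     Omega P Plus \<inter> Omega P Minus = {} \<and>
     Gamma P \<inter> Omega P Plus = {} \<and> Gamma P \<inter> Omega P Minus = {} \<and>
     {x_l P..x_r P} \<times> {y_b P..y_t P} \<subseteq> Omega P Plus \<union> Gamma P \<union> Omega P Minus \<and>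
     pos P ` grid_nodes P \<union> grid_corners P \<subseteq> Omega P Plus \<union> Omega P Minus"

definition side_of :: "tmz \<Rightarrow> node \<Rightarrow> side" where
  "side_of P s = (if pos P s \<in> Omega P Plus then Plus else Minus)"

text \<open>The value of f_{1x}, f_{1y} or f_2 at an H_x-, H_y- or E_z-node respectively.\<close>
fun src :: "tmz \<Rightarrow> real \<Rightarrow> node \<Rightarrow> real" where
  "src P t (HxN i j) = f1x P (side_of P (HxN i j)) t (pos P (HxN i j))"
| "src P t (HyN i j) = f1y P (side_of P (HyN i j)) t (pos P (HyN i j))"
| "src P t (EzN i j) = f2 P (side_of P (EzN i j)) t (pos P (EzN i j))"

text \<open>Nodes that carry the stencil values of the spatial differences evaluated at a node.\<close>
fun stencil :: "node \<Rightarrow> node set" where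
  "stencil (HxN i j) = {EzN i (j-1), EzN i j, EzN i (j+1), EzN i (j+2)}"
| "stencil (HyN i j) = {EzN (i-1) j, EzN i j, EzN (i+1) j, EzN (i+2) j}"
| "stencil (EzN i j) = {HyN (i-2) j, HyN (i-1) j, HyN i j, HyN (i+1) j}
                     \<union> {HxN i (j-2), HxN i (j-1), HxN i j, HxN i (j+1)}"

definition interior_nodes :: "tmz \<Rightarrow> node set" where
  "interior_nodes P = {s \<in> grid_nodes P. stencil s \<subseteq> grid_nodes P}"

text \<open>The polynomial in t obtained from the correction polynomial at the position of \<open>r\<close>.\<close>
definition corr_time :: "tmz \<Rightarrow> nat \<Rightarrow> node \<Rightarrow> node \<Rightarrow> real poly" where
  "corr_time P n s r =
     poly (poly (corr_poly P n s r) [:[:fst (pos P r):]:]) [:snd (pos P r):]"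

text \<open>
  The modified correction value at stage \<open>m\<close> in 1..4 of the step from t_n to t_{n+1}, for the
  stencil value at \<open>r\<close> in a finite difference evaluated at \<open>s\<close>. The formulas
  hold for the exact jumps only up to approximation; for the polynomials they are definitions.
\<close>
definition D_hat :: "tmz \<Rightarrow> nat \<Rightarrow> nat \<Rightarrow> node \<Rightarrow> node \<Rightarrow> real" where
  "D_hat P n m s r =
     (let h = dt P;
          D = (\<lambda>k. poly ((pderiv ^^ k) (corr_time P n s r)) (tm P n))
      in if m = 1 then D 0
         else if m = 2 then D 0 + h / 2 * D 1
         else if m = 3 then D 0 + h / 2 * D 1 + h^2 / 4 * D 2
         else D 0 + h * D 1 + h^2 / 2 * D 2 + h^3 / 4 * D 3)"

definition corrected ::
    "tmz \<Rightarrow> nat \<Rightarrow> nat \<Rightarrow> (node \<Rightarrow> real) \<Rightarrow> node \<Rightarrow> node \<Rightarrow> real" where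
  "corrected P n m U s r =
     (if pos P s \<in> Omega P Plus \<and> pos P r \<in> Omega P Minus then U r + D_hat P n m s r
      else if pos P s \<in> Omega P Minus \<and> pos P r \<in> Omega P Plus then U r - D_hat P n m s r
      else U r)"

definition diff4 :: "real \<Rightarrow> real \<Rightarrow> real \<Rightarrow> real \<Rightarrow> real \<Rightarrow> real" where
  "diff4 h a b c d = (a - 27 * b + 27 * c - d) / (24 * h)"

text \<open>
  The corrected differences. \<open>HyN i j\<close> lies at x_{i+1/2}, so the difference of H_y at x_i uses the
  first indices i-2, ..., i+1 (and similarly for H_x).
\<close>
fun ddx :: "tmz \<Rightarrow> nat \<Rightarrow> nat \<Rightarrow> (node \<Rightarrow> real) \<Rightarrow> node \<Rightarrow> real" where
  "ddx P n m U (HyN i j) =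
     (let V = corrected P n m U (HyN i j)
      in diff4 (dx P) (V (EzN (i-1) j)) (V (EzN i j)) (V (EzN (i+1) j)) (V (EzN (i+2) j)))"
| "ddx P n m U (EzN i j) =
     (let V = corrected P n m U (EzN i j)
      in diff4 (dx P) (V (HyN (i-2) j)) (V (HyN (i-1) j)) (V (HyN i j)) (V (HyN (i+1) j)))"
| "ddx P n m U (HxN i j) = undefined"

fun ddy :: "tmz \<Rightarrow> nat \<Rightarrow> nat \<Rightarrow> (node \<Rightarrow> real) \<Rightarrow> node \<Rightarrow> real" where
  "ddy P n m U (HxN i j) =
     (let V = corrected P n m U (HxN i j)
      in diff4 (dy P) (V (EzN i (j-1))) (V (EzN i j)) (V (EzN i (j+1))) (V (EzN i (j+2))))"
| "ddy P n m U (EzN i j) =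
     (let V = corrected P n m U (EzN i j)
      in diff4 (dy P) (V (HxN i (j-2))) (V (HxN i (j-1))) (V (HxN i j)) (V (HxN i (j+1))))"
| "ddy P n m U (HyN i j) = undefined"

text \<open>
  The right-hand side G(t, U), with the corrections of stage \<open>m\<close> of the step from t_n to t_{n+1}.
\<close>
fun G :: "tmz \<Rightarrow> nat \<Rightarrow> nat \<Rightarrow> real \<Rightarrow> (node \<Rightarrow> real) \<Rightarrow> node \<Rightarrow> real" where
  "G P n m t U (HxN i j) = 1 / mu P * (src P t (HxN i j) - ddy P n m U (HxN i j))"
| "G P n m t U (HyN i j) = 1 / mu P * (src P t (HyN i j) + ddx P n m U (HyN i j))"
| "G P n m t U (EzN i j) =
     1 / eps P * (- sigma P * U (EzN i j) + src P t (EzN i j)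
                  + ddx P n m U (EzN i j) - ddy P n m U (EzN i j))"

text \<open>
  One RK4 step from \<open>U\<close> at t_n to \<open>U'\<close> at t_{n+1}. The stage increments are prescribed at
  the nodes whose centered stencils lie in the grid and left arbitrary at the remaining nodes, so
  that every treatment of the boundary of the rectangle is covered.
\<close>
definition rk4_step :: "tmz \<Rightarrow> nat \<Rightarrow> (node \<Rightarrow> real) \<Rightarrow> (node \<Rightarrow> real) \<Rightarrow> bool" where
  "rk4_step P n U U' \<longleftrightarrow>
     (\<exists>k1 k2 k3 k4 :: node \<Rightarrow> real.
        (\<forall>s \<in> interior_nodes P.
           k1 s = dt P * G P n 1 (tm P n) U s \<and>
           k2 s = dt P * G P n 2 (tm P n + dt P / 2) (\<lambda>r. U r + k1 r / 2) s \<and>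
           k3 s = dt P * G P n 3 (tm P n + dt P / 2) (\<lambda>r. U r + k2 r / 2) s \<and>
           k4 s = dt P * G P n 4 (tm P n + dt P) (\<lambda>r. U r + k3 r) s) \<and>
        (\<forall>s \<in> grid_nodes P. U' s = U s + 1/6 * (k1 s + 2 * k2 s + 2 * k3 s + k4 s)))"

definition computed_by_scheme :: "tmz \<Rightarrow> (nat \<Rightarrow> node \<Rightarrow> real) \<Rightarrow> bool" where
  "computed_by_scheme P U \<longleftrightarrow> (\<forall>n. rk4_step P n (U n) (U (Suc n)))"

text \<open>
  The discrete divergence at the cell corner (x_{i+1/2}, y_{j+1/2}) of a staggered field, given by
  its values at the H_x- and H_y-nodes.
\<close>
definition ddiv :: "tmz \<Rightarrow> (node \<Rightarrow> real) \<Rightarrow> int \<Rightarrow> int \<Rightarrow> real" where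
  "ddiv P A i j =
     diff4 (dx P) (A (HxN (i-1) j)) (A (HxN i j)) (A (HxN (i+1) j)) (A (HxN (i+2) j))
   + diff4 (dy P) (A (HyN i (j-1))) (A (HyN i j)) (A (HyN i (j+1))) (A (HyN i (j+2)))"

definition div_stencil :: "int \<Rightarrow> int \<Rightarrow> node set" where
  "div_stencil i j =
     {HxN (i-1) j, HxN i j, HxN (i+1) j, HxN (i+2) j}
   \<union> {HyN i (j-1), HyN i j, HyN i (j+1), HyN i (j+2)}"

text \<open>
  RK4 evaluates the source at t_n, t_n + dt/2 and t_n + dt. Vanishing of its discrete divergence at
  the levels t_n alone does not prevent the two middle stages from changing the discrete divergence
  of H, so the half levels have to be included where this predicate is assumed.
\<close>
definition source_div_free_at :: "tmz \<Rightarrow> real \<Rightarrow> bool" where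
  "source_div_free_at P t \<longleftrightarrow>
     (\<forall>i j. div_stencil i j \<subseteq> grid_nodes P \<longrightarrow> ddiv P (src P t) i j = 0)"

definition uses_correction :: "tmz \<Rightarrow> node \<Rightarrow> node \<Rightarrow> bool" where
  "uses_correction P s r \<longleftrightarrow>
     s \<in> interior_nodes P \<and> r \<in> stencil s \<and>
     (pos P s \<in> Omega P Plus \<and> pos P r \<in> Omega P Minus \<or>
      pos P s \<in> Omega P Minus \<and> pos P r \<in> Omega P Plus)"

definition unique_D_Ez :: "tmz \<Rightarrow> bool" where
  "unique_D_Ez P \<longleftrightarrow>
     (\<forall>n. \<forall>m \<in> {1..4}. \<forall>i j s s'.
        uses_correction P s (EzN i j) \<and> uses_correction P s' (EzN i j) \<longrightarrow>
        D_hat P n m s (EzN i j) = D_hat P n m s' (EzN i j))"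

end

theory Submission
  imports Defs
begin

text \<open>
  Around a corner all of whose divergence nodes lie on one side, uniqueness of the correction makes
  every difference of E_z read the same corrected values. The right-hand side of Faraday's law is
  then a source minus a discrete curl, and the discrete divergence of a discrete curl vanishes
  because differences in x and y commute. Hence every Runge-Kutta increment is discretely
  divergence free, and so is the update of H.
\<close>

text \<open>The two halves of the divergence stencil serve each other: the y-indices needed by the
  E_z-stencil of an H_x-node are those of the H_y-nodes, and the x-indices needed by an H_y-node are
  those of the H_x-nodes.\<close>

lemma div_stencil_interior:
  assumes "div_stencil i j \<subseteq> grid_nodes P"
  shows "div_stencil i j \<subseteq> interior_nodes P"
  using assms by (auto simp: div_stencil_def interior_nodes_def grid_nodes_def)

text \<open>Whether the value at an E_z-node is corrected, and with which sign, depends only on the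
  side of the evaluating node, which is common to all of \<open>S\<close>. Either every difference
  reads \<open>U\<close> itself, or all add or all subtract the same unique correction.\<close>

lemma corrected_common_value:
  assumes "admissible P" "unique_D_Ez P" "m \<in> {1..4}"
    and S: "S \<subseteq> interior_nodes P" "pos P ` S \<subseteq> Omega P side"
  shows "\<exists>w. \<forall>s\<in>S. EzN k l \<in> stencil s \<longrightarrow> corrected P n m U s (EzN k l) = w"
proof -
  let ?r = "EzN k l"
  have disjoint: "Omega P Plus \<inter> Omega P Minus = {}"
    using \<open>admissible P\<close> by (simp add: admissible_def)
  have same: "corrected P n m U s ?r = corrected P n m U s' ?r"
    if s: "s \<in> S" "?r \<in> stencil s" and s': "s' \<in> S" "?r \<in> stencil s'" for s s'
  proof (cases "uses_correction P s ?r")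
    case True
    with S s s' disjoint have "uses_correction P s' ?r"
      by (cases side) (auto simp: uses_correction_def)
    with True assms(2,3) have "D_hat P n m s ?r = D_hat P n m s' ?r"
      unfolding unique_D_Ez_def by blast
    with S s s' disjoint show ?thesis
      by (cases side) (auto simp: corrected_def)
  next
    case False
    with S s s' disjoint show ?thesis
      by (cases side) (auto simp: uses_correction_def corrected_def)
  qed
  show ?thesis
  \<comment> \<open>If no stencil of \<open>S\<close> reads the node, any value serves as
    witness.\<close>
  proof (cases "\<exists>s\<in>S. ?r \<in> stencil s")
    case True
    with same show ?thesis by blast
  qed blast
qed

lemma ddiv_linear:
  "ddiv P (\<lambda>s. a * A s + b * B s) i j = a * ddiv P A i j + b * ddiv P B i j"
  by (simp add: ddiv_def diff4_def field_simps add_divide_distrib diff_divide_distrib)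

lemma ddiv_cong:
  assumes "\<And>s. s \<in> div_stencil i j \<Longrightarrow> A s = B s"
  shows "ddiv P A i j = ddiv P B i j"
  using assms by (simp add: ddiv_def div_stencil_def)

text \<open>The discrete curl of a scalar field, with components (d_y W, - d_x W), so that Faraday's
  law reads source minus curl in both components. The value at E_z-nodes is a filler that
  \<open>ddiv\<close> never reads.\<close>

fun curl4 :: "tmz \<Rightarrow> (int \<Rightarrow> int \<Rightarrow> real) \<Rightarrow> node \<Rightarrow> real" where
  "curl4 P W (HxN i j) = diff4 (dy P) (W i (j-1)) (W i j) (W i (j+1)) (W i (j+2))"
| "curl4 P W (HyN i j) = - diff4 (dx P) (W (i-1) j) (W i j) (W (i+1) j) (W (i+2) j)"
| "curl4 P W (EzN i j) = 0"

lemma ddiv_curl4: "ddiv P (curl4 P W) i j = 0"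
  by (simp add: ddiv_def diff4_def divide_simps)

text \<open>The state \<open>U\<close> is arbitrary, so this applies to every Runge-Kutta stage
  without knowledge of the intermediate states.\<close>

lemma ddiv_G:
  assumes "admissible P" "unique_D_Ez P" "m \<in> {1..4}" "source_div_free_at P t"
    and grid: "div_stencil i j \<subseteq> grid_nodes P"
    and side: "pos P ` div_stencil i j \<subseteq> Omega P side"
  shows "ddiv P (G P n m t U) i j = 0"
proof -
  have "\<forall>k l. \<exists>w. \<forall>s\<in>div_stencil i j.
      EzN k l \<in> stencil s \<longrightarrow> corrected P n m U s (EzN k l) = w"
    using corrected_common_value[OF assms(1-3) div_stencil_interior[OF grid] side] by blast
  \<comment> \<open>The chosen value depends on the E_z-node alone and not on the evaluating node,
    so \<open>W\<close> is a single grid function to which \<open>curl4\<close> applies.\<close>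
  then obtain W where W: "\<And>k l s. s \<in> div_stencil i j \<Longrightarrow> EzN k l \<in> stencil s \<Longrightarrow>
      corrected P n m U s (EzN k l) = W k l"
    by metis
  have "G P n m t U s = 1 / mu P * src P t s + (- 1 / mu P) * curl4 P W s"
    if "s \<in> div_stencil i j" for s
  proof (cases s)
    case (HxN k l)
    with W[OF that] show ?thesis by (simp add: right_diff_distrib diff_divide_distrib)
  next
    case (HyN k l)
    with W[OF that] show ?thesis by (simp add: distrib_left add_divide_distrib)
  next
    case (EzN k l)
    with that show ?thesis by (simp add: div_stencil_def)
  qed
  then have "ddiv P (G P n m t U) i j =
      ddiv P (\<lambda>s. 1 / mu P * src P t s + (- 1 / mu P) * curl4 P W s) i j"
    by (rule ddiv_cong)
  also have "\<dots> = 0"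
    using assms(4) grid by (simp only: ddiv_linear ddiv_curl4 source_div_free_at_def)
  finally show ?thesis .
qed

lemma ddiv_rk4_step:
  assumes "admissible P" "unique_D_Ez P" "rk4_step P n U U'"
    and sources: "source_div_free_at P (tm P n)" "source_div_free_at P (tm P n + dt P / 2)"
      "source_div_free_at P (tm P n + dt P)"
    and grid: "div_stencil i j \<subseteq> grid_nodes P"
    and side: "pos P ` div_stencil i j \<subseteq> Omega P side"
  shows "ddiv P U' i j = ddiv P U i j"
proof -
  obtain k1 k2 k3 k4 where
    k: "\<forall>s \<in> interior_nodes P.
           k1 s = dt P * G P n 1 (tm P n) U s \<and>
           k2 s = dt P * G P n 2 (tm P n + dt P / 2) (\<lambda>r. U r + k1 r / 2) s \<and>
           k3 s = dt P * G P n 3 (tm P n + dt P / 2) (\<lambda>r. U r + k2 r / 2) s \<and>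
           k4 s = dt P * G P n 4 (tm P n + dt P) (\<lambda>r. U r + k3 r) s"
    and U': "\<forall>s \<in> grid_nodes P. U' s = U s + 1/6 * (k1 s + 2 * k2 s + 2 * k3 s + k4 s)"
    using assms(3) unfolding rk4_step_def by blast
  have increment: "ddiv P q i j = 0"
    if q: "\<forall>s \<in> interior_nodes P. q s = dt P * G P n m t V s"
      and m: "m \<in> {1..4}" and t: "source_div_free_at P t" for q m t V
  proof -
    \<comment> \<open>The zero term gives the two-term shape of \<open>ddiv_linear\<close>.\<close>
    have "ddiv P q i j = ddiv P (\<lambda>s. dt P * G P n m t V s + 0 * U s) i j"
      using q div_stencil_interior[OF grid] by (intro ddiv_cong) auto
    also have "\<dots> = 0"
      using ddiv_G[OF assms(1,2) m t grid side] by (simp only: ddiv_linear)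
    finally show ?thesis .
  qed
  have k0: "ddiv P k1 i j = 0" "ddiv P k2 i j = 0" "ddiv P k3 i j = 0" "ddiv P k4 i j = 0"
    using k sources by (auto intro!: increment)
  \<comment> \<open>The weighted sum is nested, with explicit unit coefficients, so that
    \<open>ddiv_linear\<close> rewrites it down to the four increments.\<close>
  have "ddiv P U' i j = ddiv P (\<lambda>s. 1 * U s + 1/6 *
      (1 * (1 * k1 s + 2 * k2 s) + 1 * (2 * k3 s + 1 * k4 s))) i j"
    using U' grid by (intro ddiv_cong) auto
  also have "\<dots> = ddiv P U i j"
    by (simp only: ddiv_linear k0) simp
  finally show ?thesis .
qed

theorem theorem4p3:
  fixes P :: tmz and U :: "nat \<Rightarrow> node \<Rightarrow> real"
  assumes setting: "admissible P"
    and scheme: "computed_by_scheme P U"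
    and source: "\<And>n. source_div_free_at P (tm P n)"
    and source_half: "\<And>n. source_div_free_at P (tm P n + dt P / 2)"
    and unique: "unique_D_Ez P"
  shows "\<forall>side i j.
           div_stencil i j \<subseteq> grid_nodes P \<and>
           corner_pos P i j \<in> Omega P side \<and>
           pos P ` div_stencil i j \<subseteq> Omega P side \<longrightarrow>
           (\<forall>n. ddiv P (U (Suc n)) i j = ddiv P (U 0) i j)"
proof (intro allI impI, elim conjE)
  fix side i j n
  assume grid: "div_stencil i j \<subseteq> grid_nodes P"
    and side: "pos P ` div_stencil i j \<subseteq> Omega P side"
  \<comment> \<open>The last stage evaluates the source at the next time level, where it is
    divergence free by assumption.\<close>
  have "tm P k + dt P = tm P (Suc k)" for k
    by (simp add: tm_def distrib_right)
  then have "ddiv P (U (Suc k)) i j = ddiv P (U k) i j" for k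
    using ddiv_rk4_step[OF setting unique _ source source_half _ grid side] scheme source
    by (metis computed_by_scheme_def)
  then show "ddiv P (U (Suc n)) i j = ddiv P (U 0) i j"
    by (induction n) simp_all
qed

end
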